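(* Let $\mathbf{k}$ be an associative ring with unity $1\neq 0$ such that $\operatorname{char}(\mathbf{k})\neq 2,3$, and let $(X,\triangleright)$ be a non-trivial quandle. Then the quandle ring $\mathbf{k}[X]$ is not power-associative.
   Context: A quandle is a set $X$ with a binary operation $\triangleright$ such that: (I) $a\triangleright a=a$ for all $a\in X$; (II) for all $a,b\in X$ there is a unique $c\in X$ with $a=c\triangleright b$; (III) $(a\triangleright b)\triangleright c=(a\triangleright c)\triangleright(b\triangleright c)$ for all $a,b,c\in X$. The quandle is trivial if $a\triangleright b=a$ for all $a,b\in X$, and non-trivial otherwise. The quandle ring $\mathbf{k}[X]$ is the set of formal sums $\sum_{x\in X}a_x x$ with $a_x\in\mathbf{k}$, $a_x=0$ for almost all $x$, with the natural addition and the (generally nonassociative) multiplication $\left(\sum_{x}a_x x\right)\cdot\left(\sum_{y}b_y y\right)=\sum_{x,y}a_xb_y\,(x\triangleright y)$. A (not necessarily associative) ring is power-associative if every element generates an associative subring.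
   Formalization: The characteristics 4 and 6 of k are excluded as well as 2 and 3, because the claim fails there: Z/4 with the four-element tetrahedral quandle and Z/6 with the dihedral quandle of order 3 give power-associative quandle rings. *)

theory Defs
  imports "HOL-Computational_Algebra.Computational_Algebra" "HOL-Library.Poly_Mapping"
begin

locale quandle =
  fixes X :: "'x set"
    and tri :: "'x \<Rightarrow> 'x \<Rightarrow> 'x"  (infixl \<open>\<triangleright>\<close> 70)
  assumes closed: "a \<in> X \<Longrightarrow> b \<in> X \<Longrightarrow> a \<triangleright> b \<in> X"
    and idem: "a \<in> X \<Longrightarrow> a \<triangleright> a = a"
    and right_div: "a \<in> X \<Longrightarrow> b \<in> X \<Longrightarrow> \<exists>!c. c \<in> X \<and> a = c \<triangleright> b"
    and right_distrib: "a \<in> X \<Longrightarrow> b \<in> X \<Longrightarrow> c \<in> X \<Longrightarrow>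
      (a \<triangleright> b) \<triangleright> c = (a \<triangleright> c) \<triangleright> (b \<triangleright> c)"

definition trivial_quandle :: "'x set \<Rightarrow> ('x \<Rightarrow> 'x \<Rightarrow> 'x) \<Rightarrow> bool" where
  "trivial_quandle X tri \<longleftrightarrow> quandle X tri \<and> (\<forall>a\<in>X. \<forall>b\<in>X. tri a b = a)"

text \<open>Not necessarily associative, not necessarily unital rings on a subset of an additive
  abelian group; the addition is that of the type, the multiplication is explicit.\<close>

locale nonassoc_ring =
  fixes R :: "'r::ab_group_add set"
    and mul :: "'r \<Rightarrow> 'r \<Rightarrow> 'r"
  assumes zero_closed: "0 \<in> R"
    and add_closed: "u \<in> R \<Longrightarrow> v \<in> R \<Longrightarrow> u + v \<in> R"
    and uminus_closed: "u \<in> R \<Longrightarrow> - u \<in> R"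
    and mul_closed: "u \<in> R \<Longrightarrow> v \<in> R \<Longrightarrow> mul u v \<in> R"
    and mul_add_left: "u \<in> R \<Longrightarrow> v \<in> R \<Longrightarrow> w \<in> R \<Longrightarrow> mul (u + v) w = mul u w + mul v w"
    and mul_add_right: "u \<in> R \<Longrightarrow> v \<in> R \<Longrightarrow> w \<in> R \<Longrightarrow> mul u (v + w) = mul u v + mul u w"

text \<open>The subring generated by an element is the least subring containing it; no unit element
  is adjoined, since the ring need not have one.\<close>

definition generated_subring :: "'r::ab_group_add set \<Rightarrow> ('r \<Rightarrow> 'r \<Rightarrow> 'r) \<Rightarrow> 'r \<Rightarrow> 'r set" where
  "generated_subring R mul u = \<Inter> {S. S \<subseteq> R \<and> nonassoc_ring S mul \<and> u \<in> S}"

definition associative_on :: "'r set \<Rightarrow> ('r \<Rightarrow> 'r \<Rightarrow> 'r) \<Rightarrow> bool" where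
  "associative_on S mul \<longleftrightarrow>
     (\<forall>u\<in>S. \<forall>v\<in>S. \<forall>w\<in>S. mul (mul u v) w = mul u (mul v w))"

definition power_associative :: "'r::ab_group_add set \<Rightarrow> ('r \<Rightarrow> 'r \<Rightarrow> 'r) \<Rightarrow> bool" where
  "power_associative R mul \<longleftrightarrow> (\<forall>u\<in>R. associative_on (generated_subring R mul u) mul)"

text \<open>Formal sums are finitely supported functions whose support lies in \<^term>\<open>X\<close>. The product
  of the type \<^typ>\<open>'x \<Rightarrow>\<^sub>0 'k\<close> in the library is convolution along an addition on \<^typ>\<open>'x\<close>,
  so the product along the quandle operation is a separate function.\<close>

definition quandle_ring :: "'x set \<Rightarrow> ('x \<Rightarrow>\<^sub>0 'k::ring_1) set" where
  "quandle_ring X = {u. Poly_Mapping.keys u \<subseteq> X}"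

definition quandle_mult ::
    "('x \<Rightarrow> 'x \<Rightarrow> 'x) \<Rightarrow> ('x \<Rightarrow>\<^sub>0 'k::ring_1) \<Rightarrow> ('x \<Rightarrow>\<^sub>0 'k) \<Rightarrow> ('x \<Rightarrow>\<^sub>0 'k)" where
  "quandle_mult tri u v =
     (\<Sum>x\<in>Poly_Mapping.keys u. \<Sum>y\<in>Poly_Mapping.keys v.
        Poly_Mapping.single (tri x y) (Poly_Mapping.lookup u x * Poly_Mapping.lookup v y))"

lemma quandle_mult_superset:
  assumes "finite A" "finite B" "Poly_Mapping.keys u \<subseteq> A" "Poly_Mapping.keys v \<subseteq> B"
  shows "quandle_mult tri u v =
    (\<Sum>x\<in>A. \<Sum>y\<in>B.
        Poly_Mapping.single (tri x y) (Poly_Mapping.lookup u x * Poly_Mapping.lookup v y))"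
proof -
  have "(\<Sum>y\<in>Poly_Mapping.keys v.
          Poly_Mapping.single (tri x y) (Poly_Mapping.lookup u x * Poly_Mapping.lookup v y)) =
        (\<Sum>y\<in>B.
          Poly_Mapping.single (tri x y) (Poly_Mapping.lookup u x * Poly_Mapping.lookup v y))" for x
    by (rule sum.mono_neutral_left) (use assms in \<open>auto simp: in_keys_iff\<close>)
  then show ?thesis
    unfolding quandle_mult_def
    by (simp, intro sum.mono_neutral_left) (use assms in \<open>auto simp: in_keys_iff\<close>)
qed

lemma nonassoc_ring_quandle_ring:
  assumes "quandle X tri"
  shows "nonassoc_ring (quandle_ring X :: ('x \<Rightarrow>\<^sub>0 'k::ring_1) set) (quandle_mult tri)"
proof -
  interpret quandle X tri by fact
  have fin: "finite (Poly_Mapping.keys u)" for u :: "'x \<Rightarrow>\<^sub>0 'k" by simp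
  show ?thesis
  proof
    show "(0 :: 'x \<Rightarrow>\<^sub>0 'k) \<in> quandle_ring X" by (simp add: quandle_ring_def)
  next
    fix u v :: "'x \<Rightarrow>\<^sub>0 'k" assume "u \<in> quandle_ring X" "v \<in> quandle_ring X"
    then show "u + v \<in> quandle_ring X"
      using Poly_Mapping.keys_add[of u v] by (auto simp: quandle_ring_def)
  next
    fix u :: "'x \<Rightarrow>\<^sub>0 'k" assume "u \<in> quandle_ring X"
    then show "- u \<in> quandle_ring X" by (simp add: quandle_ring_def)
  next
    fix u v :: "'x \<Rightarrow>\<^sub>0 'k" assume uv: "u \<in> quandle_ring X" "v \<in> quandle_ring X"
    have add: "f + g \<in> quandle_ring X" if "f \<in> quandle_ring X" "g \<in> quandle_ring X"
      for f g :: "'x \<Rightarrow>\<^sub>0 'k"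
      using that Poly_Mapping.keys_add[of f g] by (auto simp: quandle_ring_def)
    have sum: "sum f A \<in> quandle_ring X" if "\<And>x. x \<in> A \<Longrightarrow> f x \<in> quandle_ring X"
      for f :: "'x \<Rightarrow> 'x \<Rightarrow>\<^sub>0 'k" and A
      using that
    proof (induction A rule: infinite_finite_induct)
      case (insert x F)
      then show ?case by (simp add: add)
    qed (simp_all add: quandle_ring_def)
    show "quandle_mult tri u v \<in> quandle_ring X"
      unfolding quandle_mult_def
      by (intro sum) (use uv closed in \<open>auto simp: quandle_ring_def\<close>)
  next
    fix u v w :: "'x \<Rightarrow>\<^sub>0 'k"
    let ?A = "Poly_Mapping.keys u \<union> Poly_Mapping.keys v" and ?B = "Poly_Mapping.keys w"
    show "quandle_mult tri (u + v) w = quandle_mult tri u w + quandle_mult tri v w"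
      using Poly_Mapping.keys_add[of u v]
      by (simp add: quandle_mult_superset[of ?A ?B] lookup_add distrib_right
          single_add sum.distrib)
  next
    fix u v w :: "'x \<Rightarrow>\<^sub>0 'k"
    let ?A = "Poly_Mapping.keys u" and ?B = "Poly_Mapping.keys v \<union> Poly_Mapping.keys w"
    show "quandle_mult tri u (v + w) = quandle_mult tri u v + quandle_mult tri u w"
      using Poly_Mapping.keys_add[of v w]
      by (simp add: quandle_mult_superset[of ?A ?B] lookup_add distrib_left
          single_add sum.distrib)
  qed
qed

end

theory Submission
  imports Defs
begin

text \<open>Power associativity is tested on \<open>u = s a + t b\<close> with \<open>a, b \<in> X\<close> and integers \<open>s, t\<close>.
  Write \<open>a b\<close> for \<open>a \<triangleright> b\<close>. Comparing \<open>u\<^sup>2 u\<close> with \<open>u u\<^sup>2\<close> for \<open>(s, t) = (1, 1), (1, -1)\<close> gives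
  \<open>2 (ab + (ba)a - a(ab) - ba) = 0\<close>; as neither 2 nor 4 vanishes in the coefficient ring, this
  forces \<open>ab = ba\<close> or \<open>ba = b\<close>. So if \<open>ab \<noteq> a\<close>, then \<open>c = ab = ba\<close>, and \<open>c\<close> commutes with \<open>a\<close> and
  \<open>b\<close> as well. Comparing then \<open>u\<^sup>2 u\<^sup>2\<close> with \<open>(u\<^sup>2 u) u\<close>, whose difference is
  \<open>s\<^sup>3t P + s\<^sup>2t\<^sup>2 Q + st\<^sup>3 R\<close>, for \<open>(s, t) = (1, 1), (1, -1), (2, 1)\<close> gives \<open>2Q = 0\<close> and \<open>6P = 0\<close>.
  The coefficient of \<open>c\<close> in \<open>Q\<close> is \<open>6\<close> and that of \<open>ca\<close> in \<open>P\<close> is \<open>3\<close> up to sign, so 12 and 18,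
  hence also 6, vanish in the coefficient ring, which the excluded characteristics rule out.\<close>

lemma quandle_mult_add_left:
  "quandle_mult tri (u + v) w = quandle_mult tri u w + quandle_mult tri v w"
  using Poly_Mapping.keys_add[of u v]
  by (simp add: quandle_mult_superset[of "Poly_Mapping.keys u \<union> Poly_Mapping.keys v"
        "Poly_Mapping.keys w"] lookup_add distrib_right single_add sum.distrib)

lemma quandle_mult_add_right:
  "quandle_mult tri u (v + w) = quandle_mult tri u v + quandle_mult tri u w"
  using Poly_Mapping.keys_add[of v w]
  by (simp add: quandle_mult_superset[of "Poly_Mapping.keys u"
        "Poly_Mapping.keys v \<union> Poly_Mapping.keys w"] lookup_add distrib_left single_add sum.distrib)

lemma quandle_mult_single:
  "quandle_mult tri (Poly_Mapping.single x p) (Poly_Mapping.single y q) =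
    Poly_Mapping.single (tri x y) (p * q)"
  by (subst quandle_mult_superset[of "{x}" "{y}"]) auto

text \<open>Integer coefficients are central, so identities over a possibly noncommutative
  coefficient ring reduce to identities between integers.\<close>

lemma quandle_mult_single_of_int:
  "quandle_mult tri (Poly_Mapping.single x (of_int p)) (Poly_Mapping.single y (of_int q)) =
    Poly_Mapping.single (tri x y) (of_int (p * q))"
  by (simp add: quandle_mult_single)

lemma lookup_single_of_int:
  "Poly_Mapping.lookup (Poly_Mapping.single x (of_int p :: 'k::ring_1)) z =
    of_int (p * of_bool (x = z))"
  by (simp add: lookup_single)

lemma generated_subring_base:
  "u \<in> generated_subring R mul u"
  by (simp add: generated_subring_def)

lemma generated_subring_mul:
  assumes "v \<in> generated_subring R mul u" "w \<in> generated_subring R mul u"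
  shows "mul v w \<in> generated_subring R mul u"
  using assms by (auto simp: generated_subring_def intro: nonassoc_ring.mul_closed)

lemma power_associative_cube:
  assumes "power_associative R mul" "u \<in> R"
  shows "mul (mul u u) u = mul u (mul u u)"
  using assms generated_subring_base[of u R mul]
  unfolding power_associative_def associative_on_def by blast

lemma power_associative_fourth:
  assumes "power_associative R mul" "u \<in> R"
  shows "mul (mul (mul u u) u) u = mul (mul u u) (mul u u)"
  using assms generated_subring_base[of u R mul] generated_subring_mul[of u R mul u u]
  unfolding power_associative_def associative_on_def by blast

lemma (in quandle) right_cancel:
  assumes "a \<in> X" "b \<in> X" "c \<in> X" "a \<triangleright> c = b \<triangleright> c"
  shows "a = b"
  using right_div[of "a \<triangleright> c" c] assms closed by metis

text \<open>The type argument fixes \<open>'k\<close>, so that statements mentioning only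
  \<open>CHAR('k)\<close> refer to the ring in \<open>power_assoc\<close>.\<close>

locale power_associative_quandle = quandle X tri
  for X :: "'x set" and tri :: "'x \<Rightarrow> 'x \<Rightarrow> 'x"  (infixl \<open>\<triangleright>\<close> 70) +
  fixes coeff_type :: "'k::ring_1 itself"
  assumes power_assoc:
    "power_associative (quandle_ring X :: ('x \<Rightarrow>\<^sub>0 'k) set) (quandle_mult tri)"
begin

lemma two_term_in_quandle_ring:
  fixes p q :: 'k
  assumes "a \<in> X" "b \<in> X"
  shows "Poly_Mapping.single a p + Poly_Mapping.single b q \<in> quandle_ring X"
  using assms Poly_Mapping.keys_add[of "Poly_Mapping.single a p" "Poly_Mapping.single b q"]
  by (auto simp: quandle_ring_def split: if_splits)

lemma cube_coefficient:
  assumes "a \<in> X" "b \<in> X"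
  shows "int CHAR('k) dvd
    s\<^sup>2 * t * (of_bool (a \<triangleright> b = z) + of_bool (b \<triangleright> a \<triangleright> a = z)
      - of_bool (a \<triangleright> (a \<triangleright> b) = z) - of_bool (b \<triangleright> a = z)) +
    s * t\<^sup>2 * (of_bool (b \<triangleright> a = z) + of_bool (a \<triangleright> b \<triangleright> b = z)
      - of_bool (b \<triangleright> (b \<triangleright> a) = z) - of_bool (a \<triangleright> b = z))"
    (is "_ dvd ?e")
proof -
  let ?u = "Poly_Mapping.single a (of_int s) + Poly_Mapping.single b (of_int t :: 'k)"
  let ?m = "quandle_mult tri"
  \<comment> \<open>(ab)a = (aa)(ba) = a(ba), so these terms cancel in the difference of the two
    cubes.\<close>
  have aba: "a \<triangleright> b \<triangleright> a = a \<triangleright> (b \<triangleright> a)" "b \<triangleright> a \<triangleright> b = b \<triangleright> (a \<triangleright> b)"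
    using assms right_distrib[of a b a] right_distrib[of b a b] by (auto simp: idem)
  have "(of_int ?e :: 'k) =
      Poly_Mapping.lookup (?m (?m ?u ?u) ?u) z - Poly_Mapping.lookup (?m ?u (?m ?u ?u)) z"
    unfolding quandle_mult_add_left quandle_mult_add_right quandle_mult_single_of_int
      lookup_add lookup_single_of_int of_int_add[symmetric] of_int_diff[symmetric]
    by (rule arg_cong[where f = of_int])
      (simp add: assms idem aba power2_eq_square algebra_simps)
  also have "\<dots> = 0"
    using power_associative_cube[OF power_assoc two_term_in_quandle_ring[OF assms(1,2)]] by simp
  finally show ?thesis
    by (simp only: of_int_eq_0_iff_char_dvd)
qed

text \<open>Here u u = s s a + 2 s t c + t t b. The commutation rules turn every product into a, b,
  c, ca, cb or one of the latter two times a or b on the right; the multiples of a and b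
  cancel.\<close>

lemma fourth_power_coefficient:
  assumes "a \<in> X" "b \<in> X"
    and c: "c = a \<triangleright> b" "c = b \<triangleright> a" "a \<triangleright> c = c \<triangleright> a" "b \<triangleright> c = c \<triangleright> b"
  shows "int CHAR('k) dvd
    s^3 * t * (of_bool (c = z) + 2 * of_bool (c \<triangleright> a \<triangleright> a = z)
      - 3 * of_bool (c \<triangleright> a = z)) +
    s\<^sup>2 * t\<^sup>2 * (of_bool (c \<triangleright> a = z) + of_bool (c \<triangleright> b = z)
      + 2 * of_bool (c \<triangleright> a \<triangleright> b = z) + 2 * of_bool (c \<triangleright> b \<triangleright> a = z)
      - 6 * of_bool (c = z)) +
    s * t^3 * (of_bool (c = z) + 2 * of_bool (c \<triangleright> b \<triangleright> b = z)
      - 3 * of_bool (c \<triangleright> b = z))"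
    (is "_ dvd ?e")
proof -
  let ?u = "Poly_Mapping.single a (of_int s) + Poly_Mapping.single b (of_int t :: 'k)"
  let ?m = "quandle_mult tri"
  have "c \<in> X"
    using assms closed by auto
  then have idems: "a \<triangleright> a = a" "b \<triangleright> b = b" "c \<triangleright> c = c"
    using assms idem by auto
  have "(of_int ?e :: 'k) =
      Poly_Mapping.lookup (?m (?m (?m ?u ?u) ?u) ?u) z
      - Poly_Mapping.lookup (?m (?m ?u ?u) (?m ?u ?u)) z"
    unfolding quandle_mult_add_left quandle_mult_add_right quandle_mult_single_of_int
      lookup_add lookup_single_of_int of_int_add[symmetric] of_int_diff[symmetric]
      idems c(1)[symmetric] c(2)[symmetric] c(3,4)
    by (rule arg_cong[where f = of_int]) algebra
  also have "\<dots> = 0"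
    using power_associative_fourth[OF power_assoc two_term_in_quandle_ring[OF assms(1,2)]] by simp
  finally show ?thesis
    by (simp only: of_int_eq_0_iff_char_dvd)
qed

lemma commute_or_fixed:
  assumes "\<not> CHAR('k) dvd 4" and ab: "a \<in> X" "b \<in> X"
  shows "a \<triangleright> b = b \<triangleright> a \<or> b \<triangleright> a = b"
proof (rule ccontr)
  assume neg: "\<not> ?thesis"
  have "b \<triangleright> a \<triangleright> a \<noteq> b \<triangleright> a"
    using right_cancel[of "b \<triangleright> a" b a] neg ab closed by auto
  note cube = cube_coefficient[OF ab, where z = "b \<triangleright> a"]
  define p :: int where "p = of_bool (a \<triangleright> b = b \<triangleright> a) + of_bool (b \<triangleright> a \<triangleright> a = b \<triangleright> a)
    - of_bool (a \<triangleright> (a \<triangleright> b) = b \<triangleright> a) - of_bool (b \<triangleright> a = b \<triangleright> a)"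
  have "int CHAR('k) dvd 2 * p"
    using dvd_diff[OF cube[of 1 1] cube[of 1 "-1"]] by (simp add: p_def algebra_simps)
  \<comment> \<open>The first two terms of \<open>p\<close> vanish and the last is 1. Whether a(ab)
    = ba is left open, hence two values.\<close>
  moreover have "p = - 1 \<or> p = - 2"
    using neg \<open>b \<triangleright> a \<triangleright> a \<noteq> b \<triangleright> a\<close> by (auto simp: p_def)
  ultimately have "int CHAR('k) dvd 2 \<or> int CHAR('k) dvd 4"
    by auto
  then have "int CHAR('k) dvd 4"
    using dvd_trans[of "int CHAR('k)" 2 4] by auto
  then show False
    using assms(1) int_dvd_int_iff[of "CHAR('k)" 4] by simp
qed

lemma char_dvd_6:
  assumes four: "\<not> CHAR('k) dvd 4" and ab: "a \<in> X" "b \<in> X" "a \<triangleright> b \<noteq> a"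
  shows "CHAR('k) dvd 6"
proof -
  define c where "c = a \<triangleright> b"
  have cX: "c \<in> X"
    using ab closed c_def by auto
  have cba: "c = b \<triangleright> a"
    using commute_or_fixed[OF four ab(2,1)] ab c_def by auto
  have ca: "c \<noteq> a" and cb: "c \<noteq> b"
    using ab idem[of a] idem[of b] right_cancel[of a b b] c_def by auto
  have ca_c: "c \<triangleright> a \<noteq> c"
    using right_cancel[of c b a] ab cX cba cb by auto
  have cb_c: "c \<triangleright> b \<noteq> c"
    using right_cancel[of c a b] ab cX c_def ca by auto
  \<comment> \<open>The alternatives ca = c and cb = c have just been excluded.\<close>
  have comm: "a \<triangleright> c = c \<triangleright> a" "b \<triangleright> c = c \<triangleright> b"
    using commute_or_fixed[OF four ab(1) cX] commute_or_fixed[OF four ab(2) cX] ca_c cb_c by auto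
  have caa: "c \<triangleright> a \<triangleright> a \<noteq> c \<triangleright> a"
    using right_cancel[of "c \<triangleright> a" c a] ab cX closed ca_c by auto
  \<comment> \<open>(ca)b = c = ab would give ca = a = aa by cancelling b, and then c = a by
    cancelling a.\<close>
  have cac: "c \<triangleright> a \<triangleright> b \<noteq> c"
    using right_cancel[of "c \<triangleright> a" a b] right_cancel[of c a a] ab cX closed c_def ca idem[of a] by auto
  have cbc: "c \<triangleright> b \<triangleright> a \<noteq> c"
    using right_cancel[of "c \<triangleright> b" b a] right_cancel[of c b b] ab cX closed cba cb idem[of b] by auto
  define P :: "'x \<Rightarrow> int" where
    "P = (\<lambda>z. of_bool (c = z) + 2 * of_bool (c \<triangleright> a \<triangleright> a = z) - 3 * of_bool (c \<triangleright> a = z))"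
  define Q :: "'x \<Rightarrow> int" where
    "Q = (\<lambda>z. of_bool (c \<triangleright> a = z) + of_bool (c \<triangleright> b = z) + 2 * of_bool (c \<triangleright> a \<triangleright> b = z)
    + 2 * of_bool (c \<triangleright> b \<triangleright> a = z) - 6 * of_bool (c = z))"
  define R :: "'x \<Rightarrow> int" where
    "R = (\<lambda>z. of_bool (c = z) + 2 * of_bool (c \<triangleright> b \<triangleright> b = z) - 3 * of_bool (c \<triangleright> b = z))"
  let ?n = "int CHAR('k)"
  have E: "?n dvd s^3 * t * P z + s\<^sup>2 * t\<^sup>2 * Q z + s * t^3 * R z" for s t z
    using fourth_power_coefficient[OF ab(1,2) c_def cba comm, of s t z]
    unfolding P_def Q_def R_def .
  have "Q c = - 6"
    using ca_c cb_c cac cbc by (simp add: Q_def)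
  \<comment> \<open>Adding the instances (1, 1) and (1, -1) cancels \<open>P\<close> and
    \<open>R\<close> and leaves 2 \<open>Q\<close>.\<close>
  then have 12: "?n dvd 12"
    using dvd_add[OF E[of 1 1 c] E[of 1 "-1" c]] by simp
  have P: "P (c \<triangleright> a) = - 3"
    using ca_c caa by (simp add: P_def)
  have "?n dvd 6 * P z" for z
  proof -
    \<comment> \<open>The multipliers 1, -3, -1 are chosen to eliminate \<open>Q\<close> and
      \<open>R\<close>: 4 - 3 - 1 = 0 and 2 - 3 + 1 = 0.\<close>
    have "?n dvd (8 * P z + 4 * Q z + 2 * R z) - 3 * (P z + Q z + R z) - (- P z + Q z - R z)"
      using dvd_diff[OF dvd_diff[OF E[of 2 1 z] dvd_mult[OF E[of 1 1 z], of 3]] E[of 1 "-1" z]]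
      by simp
    then show ?thesis
      by (simp add: algebra_simps)
  qed
  from this[of "c \<triangleright> a"] have 18: "?n dvd 18"
    by (simp add: P)
  have "?n dvd 6"
    using dvd_diff[OF 18 12] by simp
  then show ?thesis
    using int_dvd_int_iff[of "CHAR('k)" 6] by simp
qed

end

(* Characteristics 4 and 6 are excluded as well because the claim fails for them:
   Z/4 with the four-element tetrahedral quandle, Z/6 with the dihedral quandle of order 3. *)
theorem theorem3p4:
  fixes X :: "'x set" and tri :: "'x \<Rightarrow> 'x \<Rightarrow> 'x"
  assumes "CHAR('k::ring_1) \<noteq> 2" and "CHAR('k) \<noteq> 3"
    and "CHAR('k) \<noteq> 4" and "CHAR('k) \<noteq> 6"
    and "quandle X tri" and "\<not> trivial_quandle X tri"
  shows "\<not> power_associative (quandle_ring X :: ('x \<Rightarrow>\<^sub>0 'k) set) (quandle_mult tri)"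
proof
  assume "power_associative (quandle_ring X :: ('x \<Rightarrow>\<^sub>0 'k) set) (quandle_mult tri)"
  then interpret power_associative_quandle X tri "TYPE('k)"
    using assms(5) by (simp add: power_associative_quandle_def power_associative_quandle_axioms_def)
  have small: "CHAR('k) \<notin> {1, 2, 3, 4, 6}"
    using assms(1-4) CHAR_not_1 by auto
  have four: "\<not> CHAR('k) dvd 4"
  proof
    assume dvd: "CHAR('k) dvd 4"
    then have "CHAR('k) \<le> 4"
      using dvd_imp_le by auto
    then have "CHAR('k) = 0 \<or> CHAR('k) \<in> {1, 2, 3, 4}"
      unfolding insert_iff by linarith
    then show False
      using small dvd by auto
  qed
  obtain a b where "a \<in> X" "b \<in> X" "tri a b \<noteq> a"
    using assms(5,6) unfolding trivial_quandle_def by blast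
  then have dvd: "CHAR('k) dvd 6"
    using char_dvd_6[OF four] by blast
  then have "CHAR('k) \<le> 6"
    using dvd_imp_le by auto
  \<comment> \<open>The values 0 and 5 remain, and neither divides 6.\<close>
  then have "CHAR('k) = 0 \<or> CHAR('k) = 5 \<or> CHAR('k) \<in> {1, 2, 3, 4, 6}"
    unfolding insert_iff by linarith
  then show False
    using small dvd by auto
qed

end
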